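(* Let $X$ and $Y$ be abelian Polish groups. If $f:X\to Y$ is a $D$-measurable group homomorphism, then $f$ is continuous.
   Context: An abelian Polish group is a topological abelian group (written additively) whose topology is induced by a complete separable metric. A set $A\subset X$ in an abelian Polish group $X$ is called Haar meager if there exist a Borel set $B\subset X$ with $A\subset B$, a (nonempty) compact metric space $K$ and a continuous function $g:K\to X$ such that $g^{-1}(B+x)$ is meager in $K$ for all $x\in X$. Here $B+x=\{b+x: b\in B\}$. A set $A\subset X$ is called $D$-measurable if $A=B\cup M$ for some Haar meager set $M\subset X$ and some Borel set $B\subset X$. For an abelian Polish group $X$ and a topological group $Y$, a mapping $f:X\to Y$ is called $D$-measurable if $f^{-1}(U)$ is a $D$-measurable subset of $X$ for each open set $U\subset Y$. *)

theory Defs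
  imports "HOL-Analysis.Analysis"
begin

definition nowhere_dense_in :: "'k topology \<Rightarrow> 'k set \<Rightarrow> bool" where
  "nowhere_dense_in T S \<longleftrightarrow> S \<subseteq> topspace T \<and> T interior_of (T closure_of S) = {}"

definition meager_in :: "'k topology \<Rightarrow> 'k set \<Rightarrow> bool" where
  "meager_in T S \<longleftrightarrow>
     (\<exists>N :: nat \<Rightarrow> 'k set. (\<forall>n. nowhere_dense_in T (N n)) \<and> S = (\<Union>n. N n))"

text \<open>
  An abelian Polish group is a type of sort \<open>{polish_space, topological_ab_group_add}\<close>. The
  complete metric provided by \<open>polish_space\<close> is not assumed to be translation invariant.

  A definition cannot quantify over types, so the points of the compact metric space \<open>K\<close> are
  taken in \<open>nat \<Rightarrow> real\<close>, with an arbitrary metric \<open>d\<close> unrelated to the one of the product. This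
  loses no generality: a compact metric space has at most continuum many points, hence an
  isometric copy on a subset of \<open>nat \<Rightarrow> real\<close>. The lemma \<open>haar_meagerI\<close> below makes this precise.
\<close>

definition haar_meager :: "'a::{polish_space, topological_ab_group_add} set \<Rightarrow> bool" where
  "haar_meager A \<longleftrightarrow>
     (\<exists>B \<in> sets borel. A \<subseteq> B \<and>
       (\<exists>(K :: (nat \<Rightarrow> real) set) d g.
          Metric_space K d \<and> K \<noteq> {} \<and>
          compact_space (Metric_space.mtopology K d) \<and>
          continuous_map (Metric_space.mtopology K d) euclidean g \<and>
          (\<forall>x. meager_in (Metric_space.mtopology K d) {k \<in> K. g k \<in> (\<lambda>b. b + x) ` B})))"

definition D_measurable :: "'a::{polish_space, topological_ab_group_add} set \<Rightarrow> bool" where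
  "D_measurable A \<longleftrightarrow> (\<exists>B M. B \<in> sets borel \<and> haar_meager M \<and> A = B \<union> M)"

definition D_measurable_map ::
  "('a::{polish_space, topological_ab_group_add} \<Rightarrow> 'b::topological_group_add) \<Rightarrow> bool" where
  "D_measurable_map f \<longleftrightarrow> (\<forall>U. open U \<longrightarrow> D_measurable (f -` U))"

lemma nowhere_dense_in_homeomorphic_image:
  assumes "homeomorphic_map T T' h" "nowhere_dense_in T S"
  shows "nowhere_dense_in T' (h ` S)"
proof -
  have S: "S \<subseteq> topspace T" and i: "T interior_of (T closure_of S) = {}"
    using assms(2) by (auto simp: nowhere_dense_in_def)
  have "T' interior_of (T' closure_of (h ` S)) = h ` (T interior_of (T closure_of S))"
    by (simp add: homeomorphic_map_closure_of[OF assms(1) S]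
        homeomorphic_map_interior_of[OF assms(1) closure_of_subset_topspace])
  then show ?thesis
    using i image_mono[OF S, of h] homeomorphic_imp_surjective_map[OF assms(1)]
    by (simp add: nowhere_dense_in_def)
qed

lemma meager_in_homeomorphic_image:
  assumes "homeomorphic_map T T' h" "meager_in T S"
  shows "meager_in T' (h ` S)"
proof -
  from assms(2) obtain N :: "nat \<Rightarrow> _"
    where N: "\<forall>n. nowhere_dense_in T (N n)" and S: "S = \<Union> (range N)"
    unfolding meager_in_def by blast
  have "\<forall>n. nowhere_dense_in T' (h ` N n)"
    using N nowhere_dense_in_homeomorphic_image[OF assms(1)] by simp
  moreover have "h ` S = (\<Union>n. h ` N n)"
    unfolding S by (rule image_UN)
  ultimately show ?thesis
    unfolding meager_in_def by (intro exI[of _ "\<lambda>n. h ` N n"] conjI)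
qed

lemma compact_metric_inj:
  fixes K :: "'k set"
  assumes "Metric_space K d" "compact_space (Metric_space.mtopology K d)"
  obtains h :: "'k \<Rightarrow> nat \<Rightarrow> real" where "inj_on h K"
proof -
  interpret Metric_space K d by fact
  have "mtotally_bounded K"
    using assms(2) compactin_imp_mtotally_bounded compact_space_def by force
  then have "\<forall>n::nat. \<exists>F. finite F \<and> F \<subseteq> K \<and> K \<subseteq> (\<Union>x\<in>F. mball x (1 / Suc n))"
    unfolding mtotally_bounded_def by simp
  then obtain F where F: "\<And>n::nat. finite (F n)" "\<And>n. F n \<subseteq> K"
      "\<And>n. K \<subseteq> (\<Union>x\<in>F n. mball x (1 / Suc n))"
    by metis
  define s where "s = from_nat_into (\<Union>n. F n)"
  have cn: "countable (\<Union>n. F n)"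
    using F(1) by (auto intro: countable_finite)
  have "inj_on (\<lambda>x n. d x (s n)) K"
  proof (rule inj_onI, rule ccontr)
    fix x y assume xy: "x \<in> K" "y \<in> K" "(\<lambda>n. d x (s n)) = (\<lambda>n. d y (s n))" "x \<noteq> y"
    then have "d x y / 2 > 0" by simp
    then obtain n where n: "1 / real (Suc n) < d x y / 2"
      using nat_approx_posE by blast
    obtain z where z: "z \<in> F n" "z \<in> K" "d z x < 1 / Suc n"
      using F(3)[of n] xy(1) by auto
    obtain m where "z = s m"
      using z(1) cn from_nat_into_surj[of "\<Union>n. F n" z] unfolding s_def by auto
    then have "d x z = d y z" using xy(3) by metis
    then show False
      using triangle[of x z y] xy z n by (simp add: commute)
  qed
  then show ?thesis using that by blast
qed

lemma haar_meagerI: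
  fixes A :: "'a::{polish_space, topological_ab_group_add} set" and K :: "'k set"
  assumes B: "B \<in> sets borel" "A \<subseteq> B"
    and K: "Metric_space K d" "K \<noteq> {}" "compact_space (Metric_space.mtopology K d)"
    and g: "continuous_map (Metric_space.mtopology K d) euclidean g"
    and m: "\<And>x. meager_in (Metric_space.mtopology K d) {k \<in> K. g k \<in> (\<lambda>b. b + x) ` B}"
  shows "haar_meager A"
proof -
  obtain h :: "'k \<Rightarrow> nat \<Rightarrow> real" where h: "inj_on h K"
    using compact_metric_inj[OF K(1,3)] by blast
  define i where "i = inv_into K h"
  define K' where "K' = h ` K"
  define d' where "d' = (\<lambda>x y. d (i x) (i y))"
  interpret M1: Metric_space K d by fact
  have ih [simp]: "i (h x) = x" if "x \<in> K" for x
    using h that by (simp add: i_def)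
  interpret M2: Metric_space K' d'
    by unfold_locales (auto simp: d'_def K'_def M1.commute M1.triangle)
  interpret M12: Metric_space12 K d K' d' ..
  have hom: "homeomorphic_map M1.mtopology M2.mtopology h"
    by (rule M12.isometry_imp_homeomorphic_map) (auto simp: K'_def d'_def)
  interpret M21: Metric_space12 K' d' K d ..
  have homi: "homeomorphic_map M2.mtopology M1.mtopology i"
    by (rule M21.isometry_imp_homeomorphic_map) (auto simp: K'_def d'_def image_image)
  have c: "compact_space M2.mtopology"
    using K(3) hom homeomorphic_compact_space homeomorphic_map_imp_homeomorphic_space by blast
  have ci: "continuous_map M2.mtopology M1.mtopology i"
    using homi by (rule homeomorphic_imp_continuous_map)
  have cg: "continuous_map M2.mtopology euclidean (g \<circ> i)"
    using continuous_map_compose[OF ci g] .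
  have "meager_in M2.mtopology {k \<in> K'. (g \<circ> i) k \<in> (\<lambda>b. b + x) ` B}" for x
  proof -
    have "{k \<in> K'. (g \<circ> i) k \<in> (\<lambda>b. b + x) ` B} = h ` {k \<in> K. g k \<in> (\<lambda>b. b + x) ` B}"
      by (auto simp: K'_def)
    then show ?thesis
      using meager_in_homeomorphic_image[OF hom m] by simp
  qed
  then show ?thesis
    unfolding haar_meager_def using B K(2) c cg M2.Metric_space_axioms
    by (intro bexI[of _ B] conjI exI[of _ K'] exI[of _ d'] exI[of _ "g \<circ> i"])
      (auto simp: K'_def)
qed

end

theory Submission
  imports Defs
begin

text \<open>
  It suffices to show that for every neighbourhood \<open>W\<close> of zero in the target the set \<open>f -` W\<close>
  contains a neighbourhood of zero. Take a neighbourhood \<open>U\<close> of zero with \<open>U - U \<subseteq> W\<close>. Countably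
  many translates of \<open>U\<close> cover the separable target, so their preimages cover the domain; each of
  these preimages is a union of a Borel set \<open>B n\<close> and a Haar meager set \<open>M n\<close>, and since \<open>f\<close> is
  additive, \<open>B n - B n \<subseteq> f -` W\<close>. Two facts about Haar meager sets finish the proof.

  First, countable unions of Haar meager sets are Haar meager (\<open>haar_meager_UN\<close>), while the whole
  group is not (\<open>not_haar_meager_UNIV\<close>, an instance of the Baire category theorem). So some \<open>B n\<close>
  is not Haar meager. Second, if a Borel set \<open>B\<close> is not Haar meager, then \<open>B - B\<close> contains a
  neighbourhood of zero (\<open>differences_nbhd_zero\<close>).

  Both facts rest on one construction: a test map on a product of compact spaces that is an infinite
  sum of maps of the single coordinates, where the summands are chosen successively so small that
  the sum converges uniformly (\<open>exists_summable_sets\<close>, \<open>continuous_map_suminf_product\<close>). Changing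
  one coordinate translates the value by something known. For unions, the factors are the given
  test spaces, shrunk around a point, and a Kuratowski-Ulam argument
  (\<open>meager_in_product_if_sections_meager\<close>) passes from meager sections to meager sets. For
  differences, the factors have two points, the summands are elements outside \<open>B - B\<close>, and
  flipping a suitable coordinate shows that a nonmeager preimage would produce one of these elements
  as a difference (\<open>nonmeager_Baire_contains_flip\<close>). In both cases the preimages of Borel sets are
  accessible to category arguments because they have the Baire property
  (\<open>Borel_preimage_has_Baire_property\<close>).
\<close>

section \<open>Meager sets in topological spaces\<close>

lemma meager_in_iff:
  fixes T :: "'k topology"
  shows "meager_in T S \<longleftrightarrow> S \<subseteq> topspace T \<and>
     (\<exists>F :: nat \<Rightarrow> 'k set. (\<forall>n. closedin T (F n) \<and> T interior_of (F n) = {}) \<and> S \<subseteq> (\<Union>n. F n))"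
proof
  assume "meager_in T S"
  then obtain N :: "nat \<Rightarrow> 'k set" where N: "\<forall>n. nowhere_dense_in T (N n)" "S = (\<Union>n. N n)"
    unfolding meager_in_def by (elim exE conjE)
  have Nn: "N n \<subseteq> topspace T" "T interior_of (T closure_of (N n)) = {}" for n
    using N(1) unfolding nowhere_dense_in_def by simp_all
  have "S \<subseteq> topspace T"
    using Nn(1) N(2) by (simp add: UN_least)
  moreover have "S \<subseteq> (\<Union>n. T closure_of (N n))"
    unfolding N(2) by (intro UN_mono order_refl closure_of_subset Nn(1))
  ultimately show "S \<subseteq> topspace T \<and>
     (\<exists>F :: nat \<Rightarrow> 'k set. (\<forall>n. closedin T (F n) \<and> T interior_of (F n) = {}) \<and> S \<subseteq> (\<Union>n. F n))"
    using Nn(2) by (intro conjI exI[of _ "\<lambda>n. T closure_of (N n)"]) simp_all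
next
  assume "S \<subseteq> topspace T \<and>
     (\<exists>F :: nat \<Rightarrow> 'k set. (\<forall>n. closedin T (F n) \<and> T interior_of (F n) = {}) \<and> S \<subseteq> (\<Union>n. F n))"
  then obtain F :: "nat \<Rightarrow> 'k set" where S: "S \<subseteq> topspace T" "S \<subseteq> (\<Union>n. F n)"
    and F: "\<forall>n. closedin T (F n) \<and> T interior_of (F n) = {}" by (elim exE conjE)
  have "nowhere_dense_in T (S \<inter> F n)" for n
  proof -
    have "T closure_of (S \<inter> F n) \<subseteq> F n"
      using F by (simp add: closure_of_minimal)
    then have "T interior_of (T closure_of (S \<inter> F n)) \<subseteq> {}"
      using interior_of_mono F by metis
    then show ?thesis
      unfolding nowhere_dense_in_def using S(1) by auto
  qed
  moreover have "S = (\<Union>n. S \<inter> F n)" using S(2) by auto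
  ultimately show "meager_in T S"
    unfolding meager_in_def by (intro exI[of _ "\<lambda>n. S \<inter> F n"] conjI allI)
qed

lemma meager_inE:
  fixes T :: "'k topology"
  assumes "meager_in T S"
  obtains F :: "nat \<Rightarrow> 'k set" where "S \<subseteq> topspace T" "\<And>n. closedin T (F n)"
    "\<And>n. T interior_of (F n) = {}" "S \<subseteq> (\<Union>n. F n)"
proof -
  from assms obtain F :: "nat \<Rightarrow> 'k set" where "S \<subseteq> topspace T"
    "\<forall>n. closedin T (F n) \<and> T interior_of (F n) = {}" "S \<subseteq> (\<Union>n. F n)"
    unfolding meager_in_iff by (elim exE conjE)
  then show thesis by (intro that[of F]) simp_all
qed

lemma meager_inI:
  fixes F :: "nat \<Rightarrow> 'k set"
  assumes "S \<subseteq> topspace T" "\<And>n. closedin T (F n)"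
    "\<And>n. T interior_of (F n) = {}" "S \<subseteq> (\<Union>n. F n)"
  shows "meager_in T S"
  unfolding meager_in_iff using assms by (intro conjI exI[of _ F]) simp_all

lemma meager_in_subset:
  assumes "meager_in T S" "S' \<subseteq> S"
  shows "meager_in T S'"
proof -
  obtain F :: "nat \<Rightarrow> 'a set" where "S \<subseteq> topspace T" "\<And>n. closedin T (F n)"
    "\<And>n. T interior_of (F n) = {}" "S \<subseteq> (\<Union>n. F n)"
    using assms(1) by (rule meager_inE) blast
  with assms(2) show ?thesis
    by (intro meager_inI[of S' T F] order_trans[OF assms(2)])
qed

lemma meager_in_UN:
  fixes S :: "nat \<Rightarrow> 'k set"
  assumes "\<And>n. meager_in T (S n)"
  shows "meager_in T (\<Union>n. S n)"
proof -
  have "\<forall>n. \<exists>N :: nat \<Rightarrow> 'k set. (\<forall>m. nowhere_dense_in T (N m)) \<and> S n = (\<Union>m. N m)"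
    using assms unfolding meager_in_def by simp
  then obtain N :: "nat \<Rightarrow> nat \<Rightarrow> 'k set"
    where N: "\<And>n m. nowhere_dense_in T (N n m)" "\<And>n. S n = (\<Union>m. N n m)"
    by metis
  define N' where "N' k = N (fst (prod_decode k)) (snd (prod_decode k))" for k
  have "(\<Union>n. S n) = (\<Union>k. N' k)"
  proof (intro equalityI subsetI)
    fix x assume "x \<in> (\<Union>n. S n)"
    then obtain n m where "x \<in> N n m" using N(2) by blast
    then show "x \<in> (\<Union>k. N' k)"
      by (intro UN_I[of "prod_encode (n, m)"]) (simp_all add: N'_def)
  next
    fix x assume "x \<in> (\<Union>k. N' k)"
    then show "x \<in> (\<Union>n. S n)" unfolding N'_def N(2) by blast
  qed
  moreover have "\<forall>k. nowhere_dense_in T (N' k)"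
    using N(1) by (simp add: N'_def)
  ultimately show ?thesis
    unfolding meager_in_def by (intro exI[of _ N'] conjI)
qed

lemma meager_in_Un:
  assumes "meager_in T A" "meager_in T B"
  shows "meager_in T (A \<union> B)"
proof -
  define S where "S n = (if n = 0 then A else B)" for n :: nat
  have "meager_in T (\<Union>n. S n)"
    using assms by (intro meager_in_UN) (simp add: S_def)
  moreover have "S 0 \<union> S 1 \<subseteq> (\<Union>n. S n)"
    by blast
  ultimately show ?thesis
    using meager_in_subset[of T "\<Union>n. S n" "S 0 \<union> S 1"] by (simp add: S_def)
qed

lemma meager_in_closed:
  assumes "closedin T F" "T interior_of F = {}"
  shows "meager_in T F"
  using assms closedin_subset[OF assms(1)] by (intro meager_inI[where F = "\<lambda>_. F"]) simp_all

lemma meager_in_countable_UN: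
  assumes "countable I" "\<And>i. i \<in> I \<Longrightarrow> meager_in T (S i)"
  shows "meager_in T (\<Union>i\<in>I. S i)"
proof (cases "I = {}")
  case True
  then show ?thesis using meager_in_closed[of T "{}"] by simp
next
  case False
  have "meager_in T (\<Union>n. S (from_nat_into I n))"
    by (intro meager_in_UN assms(2) from_nat_into False)
  moreover have "(\<Union>n. S (from_nat_into I n)) = (\<Union>i\<in>range (from_nat_into I). S i)"
    by simp
  ultimately show ?thesis
    by (simp only: range_from_nat_into[OF False assms(1)])
qed

text \<open>
  The Baire category theorem in the form in which every contradiction below uses it.
\<close>

lemma compact_Hausdorff_open_not_meager:
  assumes "compact_space T" "Hausdorff_space T" "openin T U" "meager_in T U"
  shows "U = {}"
proof -
  obtain F :: "nat \<Rightarrow> 'a set" where F: "\<And>n. closedin T (F n)" "\<And>n. T interior_of (F n) = {}"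
      and U: "U \<subseteq> (\<Union>n. F n)"
    using assms(4) by (rule meager_inE) blast
  have "T interior_of \<Union>(range F) = {}"
    using assms(1,2) F
    by (intro Baire_category_alt disjI2 conjI compact_imp_locally_compact_space
        compact_Hausdorff_imp_regular_space) auto
  then show ?thesis
    using interior_of_maximal[OF U assms(3)] by simp
qed

text \<open>
  This allows a compact test space to be shrunk around a point while it stays compact. For an
  arbitrary closed subspace \<open>L\<close> the trace of a meager set can be all of \<open>L\<close>, but if \<open>L\<close> is the
  closure of an open set \<open>W\<close>, then a nonempty open subset of \<open>L\<close> meets \<open>W\<close> in a nonempty open
  subset of the whole space.
\<close>

lemma meager_in_subtopology_closure_of_open:
  assumes W: "openin T W" and S: "meager_in T S"
  shows "meager_in (subtopology T (T closure_of W)) (S \<inter> T closure_of W)"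
proof -
  let ?L = "T closure_of W"
  obtain F :: "nat \<Rightarrow> 'a set" where F: "\<And>n. closedin T (F n)" "\<And>n. T interior_of (F n) = {}"
      and SF: "S \<subseteq> topspace T" "S \<subseteq> (\<Union>n. F n)"
    using S by (rule meager_inE) blast
  have "subtopology T ?L interior_of (F n \<inter> ?L) = {}" for n
  proof (rule ccontr)
    assume "subtopology T ?L interior_of (F n \<inter> ?L) \<noteq> {}"
    then obtain x O' where x: "x \<in> O'" "O' \<subseteq> F n \<inter> ?L" "openin (subtopology T ?L) O'"
      by (auto simp: interior_of_def)
    then obtain V where V: "openin T V" "O' = V \<inter> ?L"
      by (auto simp: openin_subtopology)
    have "V \<inter> W \<noteq> {}"
      using x V by (auto simp: in_closure_of)
    moreover have "V \<inter> W \<subseteq> F n"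
      using x(2) V(2) closure_of_subset[OF openin_subset[OF W]] by blast
    ultimately show False
      using F(2)[of n] interior_of_maximal[of "V \<inter> W" "F n" T] V(1) W by auto
  qed
  moreover have "closedin (subtopology T ?L) (F n \<inter> ?L)" for n
    using F(1) by (auto simp: closedin_subtopology)
  ultimately show ?thesis
    using SF by (intro meager_inI[where F = "\<lambda>n. F n \<inter> ?L"]) auto
qed

section \<open>The Baire property\<close>

definition has_Baire_property :: "'k topology \<Rightarrow> 'k set \<Rightarrow> bool" where
  "has_Baire_property T S \<longleftrightarrow> (\<exists>U. openin T U \<and> meager_in T (S - U \<union> (U - S)))"

lemma has_Baire_property_open:
  assumes "openin T U"
  shows "has_Baire_property T U"
proof -
  have "meager_in T {}" by (rule meager_in_closed) simp_all
  then show ?thesis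
    unfolding has_Baire_property_def using assms by (intro exI[of _ U]) simp
qed

text \<open>
  If \<open>S\<close> equals the open set \<open>U\<close> modulo meager sets, then its complement equals the exterior of
  \<open>U\<close> modulo meager sets, since the boundary of an open set is nowhere dense.
\<close>

lemma has_Baire_property_complement:
  assumes "has_Baire_property T S" "S \<subseteq> topspace T"
  shows "has_Baire_property T (topspace T - S)"
proof -
  obtain U where U: "openin T U" "meager_in T (S - U \<union> (U - S))"
    using assms unfolding has_Baire_property_def by blast
  let ?B = "T closure_of U - U" and ?V = "topspace T - T closure_of U"
  have UT: "U \<subseteq> topspace T" and Ucl: "U \<subseteq> T closure_of U"
    using openin_subset[OF U(1)] closure_of_subset by auto
  have "T interior_of ?B = {}"
  proof (rule ccontr)
    assume "T interior_of ?B \<noteq> {}"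
    then obtain x O' where "x \<in> O'" "O' \<subseteq> ?B" "openin T O'" by (auto simp: interior_of_def)
    then have "x \<in> T closure_of U" by blast
    then obtain y where "y \<in> U" "y \<in> O'"
      using \<open>openin T O'\<close> \<open>x \<in> O'\<close> unfolding in_closure_of by blast
    then show False using \<open>O' \<subseteq> ?B\<close> by blast
  qed
  moreover have "closedin T ?B"
    using U(1) by (simp add: closedin_diff)
  ultimately have "meager_in T ((S - U \<union> (U - S)) \<union> ?B)"
    using meager_in_Un[OF U(2) meager_in_closed] by blast
  moreover have "(topspace T - S - ?V) \<union> (?V - (topspace T - S)) \<subseteq> (S - U \<union> (U - S)) \<union> ?B"
    using Ucl by blast
  ultimately have "meager_in T ((topspace T - S - ?V) \<union> (?V - (topspace T - S)))"
    by (rule meager_in_subset)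
  moreover have "openin T ?V"
    by (simp add: openin_diff)
  ultimately show ?thesis
    unfolding has_Baire_property_def by (intro exI[of _ ?V] conjI)
qed

lemma has_Baire_property_UN:
  fixes S :: "nat \<Rightarrow> 'k set"
  assumes "\<And>n. has_Baire_property T (S n)"
  shows "has_Baire_property T (\<Union>n. S n)"
proof -
  obtain U where U: "\<And>n. openin T (U n)" "\<And>n. meager_in T (S n - U n \<union> (U n - S n))"
    using assms unfolding has_Baire_property_def by metis
  have "(\<Union>n. S n) - (\<Union>n. U n) \<union> ((\<Union>n. U n) - (\<Union>n. S n)) \<subseteq> (\<Union>n. S n - U n \<union> (U n - S n))"
    by blast
  then have "meager_in T ((\<Union>n. S n) - (\<Union>n. U n) \<union> ((\<Union>n. U n) - (\<Union>n. S n)))"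
    by (rule meager_in_subset[OF meager_in_UN[OF U(2)]])
  moreover have "openin T (\<Union>n. U n)"
    using U(1) by (intro openin_Union) auto
  ultimately show ?thesis
    unfolding has_Baire_property_def by (intro exI[of _ "\<Union>n. U n"] conjI)
qed

lemma Borel_preimage_has_Baire_property:
  fixes g :: "'k \<Rightarrow> 'a::topological_space"
  assumes g: "continuous_map T euclidean g" and B: "B \<in> sets borel"
  shows "has_Baire_property T {k \<in> topspace T. g k \<in> B}"
proof -
  have "B \<in> sigma_sets UNIV {S. open S}"
    using B by (simp add: sets_borel)
  then show ?thesis
  proof induction
    case (Basic S)
    then have "openin T {k \<in> topspace T. g k \<in> S}"
      using g by (auto intro: openin_continuous_map_preimage)
    then show ?case by (rule has_Baire_property_open)
  next
    case Empty
    show ?case using has_Baire_property_open[of T "{}"] by simp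
  next
    case (Compl S)
    have "{k \<in> topspace T. g k \<in> UNIV - S} = topspace T - {k \<in> topspace T. g k \<in> S}" by auto
    then show ?case
      using has_Baire_property_complement[OF Compl.IH] by (simp add: Collect_restrict)
  next
    case (Union S)
    have "{k \<in> topspace T. g k \<in> (\<Union>n. S n)} = (\<Union>n. {k \<in> topspace T. g k \<in> S n})" by auto
    then show ?case
      using has_Baire_property_UN[OF Union.IH] by (simp only:)
  qed
qed

text \<open>
  The localization principle behind both uses of the Baire property: a set that is not meager is
  comeager in some nonempty open set.
\<close>

lemma has_Baire_property_nonmeager:
  assumes "has_Baire_property T S" "\<not> meager_in T S"
  obtains U where "openin T U" "U \<noteq> {}" "meager_in T (U - S)"
proof -
  obtain U where U: "openin T U" "meager_in T (S - U \<union> (U - S))"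
    using assms(1) unfolding has_Baire_property_def by blast
  have "U \<noteq> {}" using U(2) assms(2) by auto
  moreover have "meager_in T (U - S)" using U(2) by (rule meager_in_subset) auto
  ultimately show ?thesis using that U(1) by blast
qed

section \<open>A Kuratowski-Ulam theorem for infinite products\<close>

lemma compact_metrizable_imp_second_countable:
  assumes "compact_space T" "metrizable_space T"
  shows "second_countable T"
proof -
  obtain M d where M: "Metric_space M d" and T: "T = Metric_space.mtopology M d"
    using assms(2) unfolding metrizable_space_def by blast
  interpret Metric_space M d by fact
  have "mtotally_bounded M"
    using assms(1) T compactin_imp_mtotally_bounded compact_space_def by force
  then have "\<forall>n::nat. \<exists>F. finite F \<and> F \<subseteq> M \<and> M \<subseteq> (\<Union>x\<in>F. mball x (1 / Suc n))"
    unfolding mtotally_bounded_def by simp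
  then obtain F where F: "\<And>n::nat. finite (F n)" "\<And>n. F n \<subseteq> M"
      "\<And>n. M \<subseteq> (\<Union>x\<in>F n. mball x (1 / Suc n))"
    by metis
  define \<B> where "\<B> = (\<Union>n. (\<lambda>x. mball x (1 / Suc n)) ` F n)"
  have "\<exists>V\<in>\<B>. x \<in> V \<and> V \<subseteq> U" if U: "openin mtopology U" and x: "x \<in> U" for U x
  proof -
    obtain r where r: "r > 0" "mball x r \<subseteq> U" and xM: "x \<in> M"
      using U x unfolding openin_mtopology by blast
    obtain n where n: "1 / real (Suc n) < r / 2"
      using nat_approx_posE[of "r / 2"] r(1) by auto
    obtain z where z: "z \<in> F n" "x \<in> mball z (1 / Suc n)"
      using F(3)[of n] xM by blast
    have "mball z (1 / Suc n) \<subseteq> mball x r"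
    proof
      fix y assume y: "y \<in> mball z (1 / Suc n)"
      then have "d x y \<le> d x z + d z y" using z xM by (intro triangle) auto
      then show "y \<in> mball x r" using y z(2) n by (auto simp: commute)
    qed
    then show ?thesis
      using z r(2) unfolding \<B>_def by blast
  qed
  moreover have "countable \<B>"
    unfolding \<B>_def using F(1) by (auto intro: countable_finite)
  ultimately show ?thesis
    unfolding second_countable_def T by (intro exI[of _ \<B>]) (auto simp: \<B>_def)
qed

lemma continuous_map_fun_upd:
  assumes "u \<in> topspace (T n)"
  shows "continuous_map (product_topology T UNIV) (product_topology T UNIV) (\<lambda>p. p(n := u))"
  unfolding continuous_map_componentwise_UNIV
proof
  fix k
  show "continuous_map (product_topology T UNIV) (T k) (\<lambda>p. (p(n := u)) k)"
    using assms by (cases "k = n") (simp_all add: continuous_map_product_projection)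
qed

lemma continuous_map_fun_upd_value:
  assumes "p \<in> topspace (product_topology T UNIV)"
  shows "continuous_map (T n) (product_topology T UNIV) (\<lambda>u. p(n := u))"
  unfolding continuous_map_componentwise_UNIV
proof
  fix k
  have "p k \<in> topspace (T k)" using assms by (auto simp: PiE_iff)
  then show "continuous_map (T n) (T k) (\<lambda>u. (p(n := u)) k)"
    by (cases "k = n") simp_all
qed

lemma fun_upd_in_topspace_product:
  assumes "p \<in> topspace (product_topology T UNIV)" "u \<in> topspace (T n)"
  shows "p(n := u) \<in> topspace (product_topology T UNIV)"
  using assms by (auto simp: PiE_iff)

text \<open>
  The set of those \<open>p\<close> whose section of \<open>F\<close> in the \<open>n\<close>-th direction contains \<open>V\<close> is closed. It
  has empty interior: if it contained an open set \<open>W\<close>, then spreading \<open>W\<close> along the \<open>n\<close>-th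
  coordinate and cutting down to \<open>V\<close> would give a nonempty open subset of \<open>F\<close>.
\<close>

lemma meager_in_nowhere_dense_fibres:
  fixes T :: "'i \<Rightarrow> 'k topology"
  defines "P \<equiv> product_topology T UNIV"
  assumes F: "closedin P F" "P interior_of F = {}" and V: "openin (T n) V" "V \<noteq> {}"
  shows "meager_in P {p \<in> topspace P. \<forall>u\<in>V. p(n := u) \<in> F}"
proof (rule meager_in_closed)
  let ?H = "{p \<in> topspace P. \<forall>u\<in>V. p(n := u) \<in> F}"
  have VT: "V \<subseteq> topspace (T n)"
    using V(1) by (rule openin_subset)
  have upd: "continuous_map P P (\<lambda>p. p(n := u))" if "u \<in> topspace (T n)" for u
    unfolding P_def using that by (rule continuous_map_fun_upd)
  have "closedin P (\<Inter>u\<in>V. {p \<in> topspace P. p(n := u) \<in> F})"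
    using V(2) VT by (intro closedin_INT closedin_continuous_map_preimage[OF upd F(1)]) auto
  moreover have "?H = (\<Inter>u\<in>V. {p \<in> topspace P. p(n := u) \<in> F})"
    using V(2) by blast
  ultimately show "closedin P ?H" by simp
  show "P interior_of ?H = {}"
  proof (rule ccontr)
    assume "P interior_of ?H \<noteq> {}"
    then obtain p W where W: "openin P W" "W \<subseteq> ?H" "p \<in> W"
      by (auto simp: interior_of_def)
    then have pP: "p \<in> topspace P" by blast
    obtain v where v: "v \<in> V" using V(2) by blast
    define W' where
      "W' = {q \<in> topspace P. q n \<in> V} \<inter> (\<Union>u\<in>topspace (T n). {q \<in> topspace P. q(n := u) \<in> W})"
    have "continuous_map P (T n) (\<lambda>q. q n)"
      unfolding P_def by (simp add: continuous_map_product_projection)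
    then have "openin P {q \<in> topspace P. q n \<in> V}"
      using V(1) by (rule openin_continuous_map_preimage)
    moreover have "openin P (\<Union>u\<in>topspace (T n). {q \<in> topspace P. q(n := u) \<in> W})"
      using openin_continuous_map_preimage[OF upd W(1)] by (intro openin_Union) blast
    ultimately have "openin P W'"
      unfolding W'_def by (rule openin_Int)
    moreover have "W' \<subseteq> F"
    proof
      fix q assume "q \<in> W'"
      then obtain u where u: "q n \<in> V" "q(n := u) \<in> W"
        unfolding W'_def by blast
      then have "(q(n := u))(n := q n) \<in> F" using W(2) by blast
      then show "q \<in> F" by simp
    qed
    moreover have "p(n := v) \<in> W'"
    proof -
      have "p(n := v) \<in> topspace P"
        using pP v VT unfolding P_def by (intro fun_upd_in_topspace_product) auto
      moreover have "p n \<in> topspace (T n)"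
        using pP unfolding P_def by (auto simp: PiE_iff)
      moreover have "(p(n := v))(n := p n) \<in> W" using W(3) by simp
      ultimately show ?thesis
        unfolding W'_def using v by (intro IntI UN_I[of "p n"] CollectI conjI) simp_all
    qed
    ultimately show False
      using interior_of_maximal F(2) by blast
  qed
qed

text \<open>
  One half of the Kuratowski-Ulam theorem, with the product split as one factor against all the
  others; sections are taken by updating a point at the coordinate \<open>n\<close>, so that no second product
  space is needed. If \<open>E\<close> were not meager, it would be comeager in a nonempty open set \<open>W\<close>, say
  \<open>W - E\<close> is covered by closed nowhere dense sets \<open>F j\<close>. By the preceding lemma, applied to the
  sets \<open>V\<close> of a countable base of the factor, some \<open>p\<close> in \<open>W\<close> has only nowhere dense sections
  of the \<open>F j\<close>. Then the section of \<open>W\<close> at \<open>p\<close> is a nonempty open set covered by the meager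
  section of \<open>E\<close> and these nowhere dense sections, against the Baire category theorem.
\<close>

lemma meager_in_product_if_sections_meager:
  fixes T :: "'i \<Rightarrow> 'k topology"
  defines "P \<equiv> product_topology T UNIV"
  assumes T: "\<And>i. compact_space (T i)" "\<And>i. Hausdorff_space (T i)" "second_countable (T n)"
    and E: "has_Baire_property P E"
    and sections: "\<And>p. p \<in> topspace P \<Longrightarrow> meager_in (T n) {u \<in> topspace (T n). p(n := u) \<in> E}"
  shows "meager_in P E"
proof (rule ccontr)
  assume "\<not> meager_in P E"
  then obtain W where W: "openin P W" "W \<noteq> {}" "meager_in P (W - E)"
    using has_Baire_property_nonmeager[OF E] by blast
  obtain F :: "nat \<Rightarrow> _" where F: "\<And>j. closedin P (F j)" "\<And>j. P interior_of (F j) = {}"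
      and WF: "W - E \<subseteq> (\<Union>j. F j)"
    using W(3) by (rule meager_inE) blast
  obtain \<B> where \<B>: "countable \<B>" "\<And>V. V \<in> \<B> \<Longrightarrow> openin (T n) V"
      "\<And>U x. openin (T n) U \<Longrightarrow> x \<in> U \<Longrightarrow> \<exists>V\<in>\<B>. x \<in> V \<and> V \<subseteq> U"
    using T(3) unfolding second_countable_def by (elim exE conjE) simp
  define H where "H = (\<lambda>(V, j). {p \<in> topspace P. \<forall>u\<in>V. p(n := u) \<in> F j})"
  define I where "I = (\<B> - {{}}) \<times> (UNIV :: nat set)"
  have "countable I"
    unfolding I_def using \<B>(1) by simp
  moreover have "meager_in P (H i)" if i: "i \<in> I" for i
  proof -
    obtain V j where "i = (V, j)" "V \<in> \<B>" "V \<noteq> {}"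
      using i by (auto simp: I_def)
    then show ?thesis
      unfolding H_def P_def
      using meager_in_nowhere_dense_fibres[OF F[of j, unfolded P_def] \<B>(2)[of V]] by simp
  qed
  ultimately have "meager_in P (\<Union>i\<in>I. H i)"
    by (rule meager_in_countable_UN)
  moreover have "\<not> meager_in P W"
  proof
    assume "meager_in P W"
    moreover have "compact_space P" "Hausdorff_space P"
      unfolding P_def
      by (simp_all add: T(1,2) compact_space_product_topology Hausdorff_space_product_topology)
    ultimately show False
      using compact_Hausdorff_open_not_meager W(1,2) by metis
  qed
  ultimately have "\<not> W \<subseteq> (\<Union>i\<in>I. H i)"
    using meager_in_subset[of P "\<Union>i\<in>I. H i" W] by metis
  then obtain p where p: "p \<in> W" "p \<notin> (\<Union>i\<in>I. H i)"
    by blast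
  have pP: "p \<in> topspace P"
    using p(1) openin_subset[OF W(1)] by blast
  have upd: "continuous_map (T n) P (\<lambda>u. p(n := u))"
    using pP unfolding P_def by (rule continuous_map_fun_upd_value)
  define U where "U = {u \<in> topspace (T n). p(n := u) \<in> W}"
  define A where "A j = {u \<in> topspace (T n). p(n := u) \<in> F j}" for j
  have "meager_in (T n) (A j)" for j
  proof (rule meager_in_closed)
    show "closedin (T n) (A j)"
      unfolding A_def using upd F(1) by (rule closedin_continuous_map_preimage)
    show "T n interior_of A j = {}"
    proof (rule ccontr)
      assume "T n interior_of A j \<noteq> {}"
      then obtain x O' where O': "openin (T n) O'" "O' \<subseteq> A j" "x \<in> O'"
        by (auto simp: interior_of_def)
      then obtain V where V: "V \<in> \<B>" "x \<in> V" "V \<subseteq> O'"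
        using \<B>(3) by blast
      have "p(n := u) \<in> F j" if "u \<in> V" for u
        using that V(3) O'(2) unfolding A_def by blast
      then have "p \<in> H (V, j)"
        using pP unfolding H_def by simp
      moreover have "(V, j) \<in> I"
        using V(1,2) unfolding I_def by blast
      ultimately show False using p(2) by blast
    qed
  qed
  then have "meager_in (T n) ({u \<in> topspace (T n). p(n := u) \<in> E} \<union> (\<Union>j. A j))"
    by (intro meager_in_Un meager_in_UN sections pP)
  moreover have "U \<subseteq> {u \<in> topspace (T n). p(n := u) \<in> E} \<union> (\<Union>j. A j)"
    unfolding U_def A_def using WF by blast
  ultimately have "meager_in (T n) U"
    by (rule meager_in_subset)
  moreover have "openin (T n) U"
    unfolding U_def using upd W(1) by (rule openin_continuous_map_preimage)
  ultimately have "U = {}"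
    by (intro compact_Hausdorff_open_not_meager[OF T(1,2)])
  moreover have "p n \<in> U"
    using pP p(1) unfolding U_def P_def by (auto simp: PiE_iff)
  ultimately show False by blast
qed

section \<open>Summation of sufficiently small elements\<close>

lemma compact_translation_nbhd:
  fixes C :: "'a::{metric_space, topological_ab_group_add} set"
  assumes "compact C" "e > 0"
  obtains V where "open V" "0 \<in> V" "\<And>v c. v \<in> V \<Longrightarrow> c \<in> C \<Longrightarrow> dist (c + v) c < e"
proof -
  have "continuous_on (UNIV \<times> C) (\<lambda>(v, c). c + v :: 'a)"
    unfolding case_prod_beta
    by (intro continuous_on_add continuous_on_fst continuous_on_snd continuous_on_id)
  from continuous_on_prod_compactE[OF this assms(1) UNIV_I, of "e / 2" 0]
  obtain V where V: "0 \<in> V" "open V" "\<forall>v\<in>V. \<forall>c\<in>C. dist (c + v) c \<le> e / 2"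
    using assms(2) by (simp split: prod.splits) blast
  have "dist (c + v) c < e" if "v \<in> V" "c \<in> C" for v c
  proof -
    have "dist (c + v) c \<le> e / 2" using V(3) that by blast
    then show ?thesis using assms(2) by linarith
  qed
  then show thesis using that V(1,2) by blast
qed

text \<open>
  The complete metric of a Polish group need not be translation invariant, so a bound on the size
  of the summands does not control the increments of the partial sums. The remedy is to choose the
  sets one after the other: if \<open>H 0, ..., H (n - 1)\<close> are compact, then the partial sums of length
  \<open>n\<close> form a compact set, and all elements of some neighbourhood of zero move all points of this set
  by less than \<open>(1/2) ^ n\<close>. So \<open>H n\<close> only has to be taken inside that neighbourhood.
\<close>

lemma exists_summable_sets:
  fixes Q :: "nat \<Rightarrow> 'a::{metric_space, topological_ab_group_add} set \<Rightarrow> bool"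
  assumes Q: "\<And>n V. open V \<Longrightarrow> 0 \<in> V \<Longrightarrow> \<exists>H. compact H \<and> H \<subseteq> V \<and> Q n H"
  obtains H where "\<forall>n. Q n (H n)"
    "\<forall>s n. (\<forall>i. s i \<in> H i) \<longrightarrow> dist (sum s {..<Suc n}) (sum s {..<n}) < (1/2) ^ n"
proof -
  \<comment> \<open>A state is a pair of the chosen set \<open>H\<close> and the compact set \<open>C\<close> of the partial sums so far.\<close>
  define good where "good n = (\<lambda>(H, C). compact H \<and> compact C \<and> Q n H \<and> (n = 0 \<longrightarrow> 0 \<in> C) \<and>
    (\<forall>v\<in>H. \<forall>c\<in>C. dist (c + v) c < (1/2) ^ n))" for n :: nat
  have ex: "\<exists>H. good n (H, C)" if C: "compact C" "n = 0 \<longrightarrow> 0 \<in> C" for n C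
  proof -
    obtain V where V: "open V" "0 \<in> V" "\<And>v c. v \<in> V \<Longrightarrow> c \<in> C \<Longrightarrow> dist (c + v) c < (1/2) ^ n"
      using compact_translation_nbhd[OF C(1), of "(1/2) ^ n"] by auto
    obtain H where H: "compact H" "H \<subseteq> V" "Q n H"
      using Q[OF V(1,2)] by blast
    then have "good n (H, C)"
      unfolding good_def using C V(3) by auto
    then show ?thesis ..
  qed
  have "\<exists>f. \<forall>n. good n (f n) \<and> snd (f (Suc n)) = (\<lambda>(c, v). c + v) ` (snd (f n) \<times> fst (f n))"
  proof (rule dependent_nat_choice)
    show "\<exists>x. good 0 x"
      using ex[of "{0}" 0] by auto
    show "\<exists>y. good (Suc n) y \<and> snd y = (\<lambda>(c, v). c + v) ` (snd x \<times> fst x)" if x: "good n x" for x n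
    proof -
      have "compact (snd x \<times> fst x)"
        using x by (intro compact_Times) (auto simp: good_def)
      then have "compact ((\<lambda>(c, v). c + v) ` (snd x \<times> fst x))"
        by (intro compact_continuous_image) (auto simp: case_prod_beta intro!: continuous_intros)
      then obtain H where "good (Suc n) (H, (\<lambda>(c, v). c + v) ` (snd x \<times> fst x))"
        using ex by blast
      then show ?thesis by (metis snd_conv)
    qed
  qed
  then obtain f where f: "\<And>n. good n (f n)"
      "\<And>n. snd (f (Suc n)) = (\<lambda>(c, v). c + v) ` (snd (f n) \<times> fst (f n))"
    by blast
  have good: "Q n (fst (f n))" "n = 0 \<longrightarrow> 0 \<in> snd (f n)"
      "v \<in> fst (f n) \<Longrightarrow> c \<in> snd (f n) \<Longrightarrow> dist (c + v) c < (1/2) ^ n" for n v c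
    using f(1)[of n] by (auto simp: good_def)
  have step: "dist (sum s {..<Suc n}) (sum s {..<n}) < (1/2) ^ n" if s: "\<And>i. s i \<in> fst (f i)" for s n
  proof -
    have "sum s {..<n} \<in> snd (f n)" for n
    proof (induction n)
      case 0
      show ?case using good(2)[of 0] by simp
    next
      case (Suc n)
      have "(\<lambda>(c, v). c + v) (sum s {..<n}, s n) \<in> snd (f (Suc n))"
        unfolding f(2) using Suc s by blast
      then show ?case by simp
    qed
    then show ?thesis
      using good(3)[OF s, of "sum s {..<n}" n] by simp
  qed
  show thesis
    by (rule that[of "\<lambda>n. fst (f n)"]) (simp_all add: good(1) step del: sum.lessThan_Suc)
qed

text \<open>
  The partial sums converge uniformly on the product, at rate \<open>2 * (1/2) ^ n\<close>, and each of them is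
  continuous because it depends on finitely many coordinates.
\<close>

lemma continuous_map_suminf_product:
  fixes T :: "nat \<Rightarrow> 'k topology"
    and h :: "nat \<Rightarrow> 'k \<Rightarrow> 'a::{complete_space, topological_ab_group_add}"
  defines "P \<equiv> product_topology T UNIV"
  assumes h: "\<And>n. continuous_map (T n) euclidean (h n)"
    and small: "\<And>p n. p \<in> topspace P \<Longrightarrow>
      dist (\<Sum>i<Suc n. h i (p i)) (\<Sum>i<n. h i (p i)) < (1/2) ^ n"
  obtains g where "continuous_map P euclidean g"
    "\<forall>p\<in>topspace P. (\<lambda>n. h n (p n)) sums g p"
proof -
  define S where "S n p = (\<Sum>i<n. h i (p i))" for n p
  have contS: "continuous_map P euclidean (S n)" for n
  proof -
    have "continuous_map P (T i) (\<lambda>p. p i)" for i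
      unfolding P_def by (simp add: continuous_map_product_projection)
    then have "continuous_map P euclidean (h i \<circ> (\<lambda>p. p i))" for i
      using h by (rule continuous_map_compose)
    then show ?thesis
      unfolding S_def continuous_map_atin by (auto intro!: tendsto_sum simp: o_def)
  qed
  have tail: "dist (S (n + k) p) (S n p) \<le> 2 * (1/2) ^ n" if p: "p \<in> topspace P" for n k p
  proof -
    \<comment> \<open>The geometric sum in closed form makes the induction go through.\<close>
    have "dist (S (n + k) p) (S n p) \<le> 2 * (1/2) ^ n - 2 * (1/2) ^ (n + k)"
    proof (induction k)
      case (Suc k)
      have "dist (S (n + Suc k) p) (S n p)
          \<le> dist (S (Suc (n + k)) p) (S (n + k) p) + dist (S (n + k) p) (S n p)"
        using dist_triangle by simp
      also have "\<dots> \<le> (1/2) ^ (n + k) + (2 * (1/2) ^ n - 2 * (1/2) ^ (n + k))"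
        using small[OF p, of "n + k"] Suc unfolding S_def by linarith
      also have "\<dots> = 2 * (1/2) ^ n - 2 * (1/2) ^ (n + Suc k)"
        by simp
      finally show ?case .
    qed simp
    moreover have "0 \<le> 2 * (1/2 :: real) ^ (n + k)" by simp
    ultimately show ?thesis by linarith
  qed
  have null: "(\<lambda>n. 2 * (1/2 :: real) ^ n) \<longlonglongrightarrow> 0"
    using tendsto_mult_right_zero[OF LIMSEQ_power_zero[of "1/2 :: real"], of 2] by simp
  have conv: "convergent (\<lambda>n. S n p)" if p: "p \<in> topspace P" for p
  proof -
    have "Cauchy (\<lambda>n. S n p)"
      unfolding Cauchy_altdef2
    proof (intro allI impI)
      fix e :: real assume "0 < e"
      then obtain N where N: "2 * (1/2) ^ N < e"
        using order_tendstoD(2)[OF null] unfolding eventually_sequentially by blast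
      have "dist (S n p) (S N p) < e" if "n \<ge> N" for n
        using tail[OF p, of N "n - N"] that N by simp
      then show "\<exists>N. \<forall>n\<ge>N. dist (S n p) (S N p) < e" by blast
    qed
    then show ?thesis by (rule Cauchy_convergent)
  qed
  define g where "g p = lim (\<lambda>n. S n p)" for p
  have lim: "(\<lambda>n. S n p) \<longlonglongrightarrow> g p" if "p \<in> topspace P" for p
    using conv[OF that] unfolding g_def by (simp add: convergent_LIMSEQ_iff)
  have bound: "dist (S n p) (g p) \<le> 2 * (1/2) ^ n" if p: "p \<in> topspace P" for n p
  proof (rule tendsto_upperbound)
    show "(\<lambda>k. dist (S n p) (S (n + k) p)) \<longlonglongrightarrow> dist (S n p) (g p)"
      using LIMSEQ_ignore_initial_segment[OF lim[OF p], of n]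
      by (intro tendsto_dist tendsto_const) (simp add: add.commute)
    show "\<forall>\<^sub>F k in sequentially. dist (S n p) (S (n + k) p) \<le> 2 * (1/2) ^ n"
      using tail[OF p] by (simp add: dist_commute)
  qed simp
  have "continuous_map P (Met_TC.mtopology :: 'a topology) g"
  proof (rule Met_TC.continuous_map_uniform_limit)
    show "\<forall>\<^sub>F n in sequentially. continuous_map P Met_TC.mtopology (S n)"
      using contS by simp
    show "\<forall>\<^sub>F n in sequentially. \<forall>p\<in>topspace P. g p \<in> UNIV \<and> dist (S n p) (g p) < e"
      if "0 < e" for e
      using order_tendstoD(2)[OF null that]
      by eventually_elim (intro ballI conjI UNIV_I le_less_trans[OF bound])
  qed simp
  then show thesis
    using lim by (intro that[of g] ballI) (simp_all add: sums_def S_def)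
qed

text \<open>
  Along one coordinate, the sum map is a translate of the summand of this coordinate.
\<close>

lemma sums_fun_upd:
  fixes h :: "nat \<Rightarrow> 'k \<Rightarrow> 'a::{t2_space, topological_ab_group_add}"
  assumes "(\<lambda>i. h i (p i)) sums a"
  shows "(\<lambda>i. h i ((p(n := u)) i)) sums (h n u + (a - h n (p n)))"
proof -
  have "(\<lambda>i. if i \<in> {n} then h i u else h i (p i)) sums (h n u + (a - h n (p n)))"
    using assms by (rule sums_If_finite_set') simp_all
  moreover have "(\<lambda>i. if i \<in> {n} then h i u else h i (p i)) = (\<lambda>i. h i ((p(n := u)) i))"
    by auto
  ultimately show ?thesis by simp
qed

section \<open>Haar meager sets\<close>

text \<open>
  The metric of the test space is replaced by metrizability, and \<open>g k \<in> B + x\<close> is written as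
  \<open>g k - x \<in> B\<close>, so that preimages of translates of \<open>B\<close> become preimages of \<open>B\<close> under a
  continuous map.
\<close>

definition haar_meager_witness ::
  "'a::{polish_space, topological_ab_group_add} set \<Rightarrow> 'k topology \<Rightarrow> ('k \<Rightarrow> 'a) \<Rightarrow> bool" where
  "haar_meager_witness B T g \<longleftrightarrow>
     compact_space T \<and> metrizable_space T \<and> topspace T \<noteq> {} \<and> continuous_map T euclidean g \<and>
     (\<forall>x. meager_in T {k \<in> topspace T. g k - x \<in> B})"

lemma mem_translate_iff: "y \<in> (\<lambda>b. b + x) ` B \<longleftrightarrow> y - x \<in> B" for y :: "'a::ab_group_add"
  by (metis (no_types, lifting) add_diff_cancel diff_add_cancel image_iff)

lemma haar_meagerI_witness:
  assumes "B \<in> sets borel" "A \<subseteq> B" "haar_meager_witness B T g"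
  shows "haar_meager A"
proof -
  obtain M d where M: "Metric_space M d" and T: "T = Metric_space.mtopology M d"
    using assms(3) unfolding haar_meager_witness_def metrizable_space_def by blast
  have "topspace T = M"
    unfolding T using Metric_space.topspace_mtopology[OF M] .
  then show ?thesis
    using assms unfolding haar_meager_witness_def T
    by (intro haar_meagerI[OF assms(1,2) M, where g = g]) (simp_all add: mem_translate_iff)
qed

lemma haar_meagerE_witness:
  fixes A :: "'a::{polish_space, topological_ab_group_add} set"
  assumes "haar_meager A"
  obtains B and T :: "(nat \<Rightarrow> real) topology" and g where
    "B \<in> sets borel" "A \<subseteq> B" "haar_meager_witness B T g"
proof -
  obtain B K d g where B: "B \<in> sets borel" "A \<subseteq> B"
    and K: "Metric_space (K :: (nat \<Rightarrow> real) set) d" "K \<noteq> {}" "compact_space (Metric_space.mtopology K d)"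
      "continuous_map (Metric_space.mtopology K d) euclidean g"
      "\<forall>x. meager_in (Metric_space.mtopology K d) {k \<in> K. g k \<in> (\<lambda>b. b + x) ` B}"
    using assms unfolding haar_meager_def by (elim bexE conjE exE)
  have "haar_meager_witness B (Metric_space.mtopology K d) g"
    unfolding haar_meager_witness_def Metric_space.topspace_mtopology[OF K(1)]
    using K(2-5) Metric_space.metrizable_space_mtopology[OF K(1)]
    by (simp add: mem_translate_iff)
  with B show thesis by (rule that)
qed

lemma not_haar_meager_UNIV: "\<not> haar_meager (UNIV :: 'a::{polish_space, topological_ab_group_add} set)"
proof
  assume "haar_meager (UNIV :: 'a set)"
  then obtain B and T :: "(nat \<Rightarrow> real) topology" and g where
    *: "(UNIV :: 'a set) \<subseteq> B" "haar_meager_witness B T g"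
    by (rule haar_meagerE_witness)
  then have B: "B = UNIV" by blast
  have T: "compact_space T" "metrizable_space T" "topspace T \<noteq> {}"
    and m: "meager_in T {k \<in> topspace T. g k - 0 \<in> B}"
    using *(2) unfolding haar_meager_witness_def by blast+
  have "meager_in T (topspace T)"
    using m unfolding B by simp
  then show False
    using compact_Hausdorff_open_not_meager[OF T(1) metrizable_imp_Hausdorff_space[OF T(2)] openin_topspace] T(3)
    by blast
qed

lemma continuous_map_minus_const:
  fixes g :: "'k \<Rightarrow> 'a::topological_ab_group_add"
  assumes "continuous_map T euclidean g"
  shows "continuous_map T euclidean (\<lambda>k. g k - x)"
  using assms unfolding continuous_map_atin by (simp add: tendsto_diff)

text \<open>
  Translating \<open>g\<close> moves the image of a chosen point \<open>a\<close> to zero, and restricting to the closure of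
  a small open neighbourhood of \<open>a\<close> makes the image small. This is what allows witnesses for
  infinitely many sets to be added up.
\<close>

lemma haar_meager_witness_small:
  fixes T :: "'k topology"
  assumes w: "haar_meager_witness B T g" and V: "open V" "0 \<in> V"
  obtains T' :: "'k topology" and h where "haar_meager_witness B T' h" "h ` topspace T' \<subseteq> V"
proof -
  have T: "compact_space T" "metrizable_space T" "topspace T \<noteq> {}" "continuous_map T euclidean g"
    and m: "\<And>x. meager_in T {k \<in> topspace T. g k - x \<in> B}"
    using w unfolding haar_meager_witness_def by blast+
  obtain a where a: "a \<in> topspace T" using T(3) by blast
  define h where "h k = g k - g a" for k
  have h: "continuous_map T euclidean h"
    unfolding h_def using T(4) by (rule continuous_map_minus_const)
  have "closedin T (topspace T - {k \<in> topspace T. h k \<in> V})"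
    using openin_continuous_map_preimage[OF h, of V] V(1) by (intro closedin_diff) simp_all
  moreover have "a \<in> topspace T - (topspace T - {k \<in> topspace T. h k \<in> V})"
    using a V(2) by (simp add: h_def)
  ultimately obtain W where W: "openin T W" "a \<in> W"
      "disjnt (topspace T - {k \<in> topspace T. h k \<in> V}) (T closure_of W)"
    using metrizable_imp_regular_space[OF T(2)] unfolding regular_space by meson
  define T' where "T' = subtopology T (T closure_of W)"
  have top': "topspace T' = T closure_of W"
    unfolding T'_def using Int_absorb1[OF closure_of_subset_topspace[of T W]] by simp
  have "meager_in T' {k \<in> topspace T'. h k - x \<in> B}" for x
  proof -
    have "meager_in T' ({k \<in> topspace T. g k - (g a + x) \<in> B} \<inter> T closure_of W)"
      unfolding T'_def using W(1) m by (rule meager_in_subtopology_closure_of_open)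
    moreover have "{k \<in> topspace T'. h k - x \<in> B} \<subseteq> {k \<in> topspace T. g k - (g a + x) \<in> B} \<inter> T closure_of W"
      using closure_of_subset_topspace[of T W] unfolding top' h_def by (auto simp: diff_diff_eq)
    ultimately show ?thesis by (rule meager_in_subset)
  qed
  moreover have "compact_space T'"
    unfolding T'_def
    by (intro compact_space_subtopology closedin_compact_space T(1) closedin_closure_of)
  moreover have "metrizable_space T'"
    unfolding T'_def using T(2) by (rule metrizable_space_subtopology)
  moreover have "topspace T' \<noteq> {}"
    unfolding top' using W(2) closure_of_subset[OF openin_subset[OF W(1)]] by blast
  moreover have "continuous_map T' euclidean h"
    unfolding T'_def using h by (rule continuous_map_from_subtopology)
  ultimately have "haar_meager_witness B T' h"
    unfolding haar_meager_witness_def by blast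
  moreover have "h ` topspace T' \<subseteq> V"
    using W(3) closure_of_subset_topspace[of T W] unfolding top' disjnt_def by blast
  ultimately show thesis by (rule that)
qed

text \<open>
  The Haar meager sets form a \<open>\<sigma>\<close>-ideal (Darji). Given witnesses \<open>h n\<close> on \<open>T n\<close>, taken so small
  that their sum converges, the map \<open>p \<mapsto> (\<Sum>n. h n (p n))\<close> on the product of the spaces \<open>T n\<close>
  is a witness for all the sets simultaneously: along the \<open>n\<close>-th coordinate it is a translate of
  \<open>h n\<close>, so all sections of the preimage of a translate of \<open>B n\<close> are meager, and the
  Kuratowski-Ulam theorem applies.
\<close>

theorem haar_meager_UN:
  fixes A :: "nat \<Rightarrow> 'a::{polish_space, topological_ab_group_add} set"
  assumes "\<And>n. haar_meager (A n)"
  shows "haar_meager (\<Union>n. A n)"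
proof -
  have "\<forall>n. \<exists>B. B \<in> sets borel \<and> A n \<subseteq> B \<and>
      (\<exists>(T :: (nat \<Rightarrow> real) topology) g. haar_meager_witness B T g)"
    using assms haar_meagerE_witness by metis
  then obtain B where B: "\<And>n. B n \<in> sets borel" "\<And>n. A n \<subseteq> B n"
      "\<And>n. \<exists>(T :: (nat \<Rightarrow> real) topology) g. haar_meager_witness (B n) T g"
    by metis
  define Q where "Q n H \<longleftrightarrow>
    (\<exists>(T :: (nat \<Rightarrow> real) topology) h. haar_meager_witness (B n) T h \<and> h ` topspace T = H)" for n H
  have small: "\<exists>H. compact H \<and> H \<subseteq> V \<and> Q n H" if V: "open V" "0 \<in> V" for n V
  proof -
    obtain T :: "(nat \<Rightarrow> real) topology" and h
      where w: "haar_meager_witness (B n) T h" "h ` topspace T \<subseteq> V"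
      using B(3)[of n] haar_meager_witness_small V by metis
    then have "compactin euclidean (h ` topspace T)"
      unfolding haar_meager_witness_def compact_space_def by (intro image_compactin[of T]) simp_all
    then show ?thesis
      using w unfolding Q_def by (intro exI[of _ "h ` topspace T"] conjI exI[of _ T] exI[of _ h]) simp_all
  qed
  obtain H where H: "\<forall>n. Q n (H n)"
    "\<forall>s n. (\<forall>i. s i \<in> H i) \<longrightarrow> dist (sum s {..<Suc n}) (sum s {..<n}) < (1/2) ^ n"
    by (rule exists_summable_sets[of Q, OF small])
  have "\<forall>n. \<exists>(T :: (nat \<Rightarrow> real) topology) h. haar_meager_witness (B n) T h \<and> h ` topspace T = H n"
    using H(1) unfolding Q_def by simp
  then obtain T :: "nat \<Rightarrow> (nat \<Rightarrow> real) topology" and h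
    where w: "\<And>n. haar_meager_witness (B n) (T n) (h n)" and hT: "\<And>n. h n ` topspace (T n) = H n"
    by metis
  have T: "compact_space (T n)" "metrizable_space (T n)" "topspace (T n) \<noteq> {}"
      "continuous_map (T n) euclidean (h n)" "meager_in (T n) {k \<in> topspace (T n). h n k - x \<in> B n}" for n x
    using w[of n] unfolding haar_meager_witness_def by simp_all
  let ?P = "product_topology T UNIV"
  have h_small: "dist (\<Sum>i<Suc n. h i (p i)) (\<Sum>i<n. h i (p i)) < (1/2) ^ n" if "p \<in> topspace ?P" for p n
    using that by (intro H(2)[rule_format]) (auto simp: PiE_iff simp flip: hT)
  obtain g where g: "continuous_map ?P euclidean g"
      "\<forall>p\<in>topspace ?P. (\<lambda>n. h n (p n)) sums g p"
    by (rule continuous_map_suminf_product[of T h, OF T(4) h_small])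
  have "meager_in ?P {p \<in> topspace ?P. g p - x \<in> B n}" for n x
  proof (rule meager_in_product_if_sections_meager)
    show "compact_space (T i)" "Hausdorff_space (T i)" for i
      using T(1,2) metrizable_imp_Hausdorff_space by blast+
    show "second_countable (T n)"
      using T(1,2) by (rule compact_metrizable_imp_second_countable)
    show "has_Baire_property ?P {p \<in> topspace ?P. g p - x \<in> B n}"
      using continuous_map_minus_const[OF g(1)] B(1) by (rule Borel_preimage_has_Baire_property)
    fix p assume p: "p \<in> topspace ?P"
    have upd: "g (p(n := u)) = h n u + (g p - h n (p n))" if "u \<in> topspace (T n)" for u
      using bspec[OF g(2) fun_upd_in_topspace_product[OF p that]] sums_fun_upd[of h p, OF bspec[OF g(2) p]]
      by (rule sums_unique2)
    have section_eq: "g (p(n := u)) - x = h n u - (x - (g p - h n (p n)))"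
      if "u \<in> topspace (T n)" for u
      unfolding upd[OF that] by (simp add: algebra_simps)
    have "{u \<in> topspace (T n). p(n := u) \<in> {p \<in> topspace ?P. g p - x \<in> B n}}
        \<subseteq> {u \<in> topspace (T n). h n u - (x - (g p - h n (p n))) \<in> B n}"
    proof
      fix u assume u: "u \<in> {u \<in> topspace (T n). p(n := u) \<in> {p \<in> topspace ?P. g p - x \<in> B n}}"
      then have uT: "u \<in> topspace (T n)" by blast
      with u show "u \<in> {u \<in> topspace (T n). h n u - (x - (g p - h n (p n))) \<in> B n}"
        unfolding mem_Collect_eq section_eq[OF uT] by blast
    qed
    with T(5) show "meager_in (T n) {u \<in> topspace (T n). p(n := u) \<in> {p \<in> topspace ?P. g p - x \<in> B n}}"
      by (rule meager_in_subset)
  qed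
  then have "meager_in ?P (\<Union>n. {p \<in> topspace ?P. g p - x \<in> B n})" for x
    by (rule meager_in_UN)
  moreover have "(\<Union>n. {p \<in> topspace ?P. g p - x \<in> B n}) = {p \<in> topspace ?P. g p - x \<in> (\<Union>n. B n)}" for x
    by blast
  moreover have "compact_space ?P"
    using T(1) by (simp add: compact_space_product_topology)
  moreover have "metrizable_space ?P"
    using T(2) by (simp add: metrizable_space_product_topology)
  moreover have "topspace ?P \<noteq> {}"
    using T(3) by (simp add: PiE_eq_empty_iff)
  ultimately have "haar_meager_witness (\<Union>n. B n) ?P g"
    unfolding haar_meager_witness_def using g(1) by simp
  moreover have "(\<Union>n. B n) \<in> sets borel"
    using B(1) by blast
  moreover have "(\<Union>n. A n) \<subseteq> (\<Union>n. B n)"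
    using B(2) by blast
  ultimately show ?thesis
    by (intro haar_meagerI_witness[of "\<Union>n. B n"])
qed


section \<open>Differences of Borel sets that are not Haar meager\<close>

lemma continuous_map_flip_coordinate:
  "continuous_map (product_topology (\<lambda>_. discrete_topology (UNIV :: bool set)) UNIV)
     (product_topology (\<lambda>_. discrete_topology UNIV) UNIV) (\<lambda>p. p(n := \<not> p n))"
  unfolding continuous_map_componentwise_UNIV
proof
  fix k
  let ?P = "product_topology (\<lambda>_. discrete_topology (UNIV :: bool set)) UNIV"
  have proj: "continuous_map ?P (discrete_topology UNIV) (\<lambda>p. p i)" for i
    using continuous_map_product_projection[of i UNIV "\<lambda>_. discrete_topology (UNIV :: bool set)"] by simp
  have "continuous_map ?P (discrete_topology UNIV) (Not \<circ> (\<lambda>p. p n))"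
    using proj by (rule continuous_map_compose) simp
  then show "continuous_map ?P (discrete_topology UNIV) (\<lambda>p. (p(n := \<not> p n)) k)"
    using proj by (cases "k = n") (simp_all add: o_def)
qed

text \<open>
  A nonmeager set with the Baire property is comeager in a basic open set of the Cantor space. Such
  a set restricts only finitely many coordinates, hence it is invariant under flipping any other
  one, and a comeager set meets its image under this homeomorphism.
\<close>

lemma nonmeager_Baire_contains_flip:
  fixes E :: "(nat \<Rightarrow> bool) set"
  defines "P \<equiv> product_topology (\<lambda>_. discrete_topology (UNIV :: bool set)) (UNIV :: nat set)"
  assumes E: "has_Baire_property P E" "\<not> meager_in P E"
  obtains p n where "p \<in> E" "p(n := \<not> p n) \<in> E"
proof -
  obtain W where W: "openin P W" "W \<noteq> {}" "meager_in P (W - E)"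
    using E by (rule has_Baire_property_nonmeager)
  obtain q where q: "q \<in> W" using W(2) by blast
  have "\<exists>U. finite {i. U i \<noteq> (UNIV :: bool set)} \<and> q \<in> Pi\<^sub>E UNIV U \<and> Pi\<^sub>E UNIV U \<subseteq> W"
    using bspec[OF iffD1[OF openin_product_topology_alt W(1)[unfolded P_def]] q] by simp
  then obtain U where U: "finite {i. U i \<noteq> (UNIV :: bool set)}" "q \<in> Pi\<^sub>E UNIV U" "Pi\<^sub>E UNIV U \<subseteq> W"
    by (elim exE conjE)
  obtain n where n: "U n = UNIV"
    using ex_new_if_finite[OF infinite_UNIV_nat U(1)] by blast
  define \<phi> where "\<phi> p = p(n := \<not> p n)" for p :: "nat \<Rightarrow> bool"
  have invol: "\<phi> (\<phi> p) = p" for p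
    by (simp add: \<phi>_def)
  have cont: "continuous_map P P \<phi>"
    unfolding \<phi>_def P_def by (rule continuous_map_flip_coordinate)
  then have hom: "homeomorphic_map P P \<phi>"
    by (intro homeomorphic_maps_imp_map[of P P \<phi> \<phi>]) (simp add: homeomorphic_maps_def invol)
  have inv: "\<phi> p \<in> Pi\<^sub>E UNIV U" if "p \<in> Pi\<^sub>E UNIV U" for p
    using that n by (auto simp: \<phi>_def PiE_iff)
  have "openin P (Pi\<^sub>E UNIV U)"
    unfolding P_def openin_PiE_gen using U(1) by simp
  moreover have "compact_space P" "Hausdorff_space P"
    unfolding P_def
    by (simp_all add: compact_space_product_topology Hausdorff_space_product_topology compact_space_discrete_topology)
  ultimately have "\<not> meager_in P (Pi\<^sub>E UNIV U)"
    using compact_Hausdorff_open_not_meager[of P "Pi\<^sub>E UNIV U"] U(2) by blast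
  moreover have "meager_in P ((W - E) \<union> \<phi> ` (W - E))"
    using W(3) meager_in_homeomorphic_image[OF hom W(3)] by (rule meager_in_Un)
  ultimately have "\<not> Pi\<^sub>E UNIV U \<subseteq> (W - E) \<union> \<phi> ` (W - E)"
    using meager_in_subset[of P "(W - E) \<union> \<phi> ` (W - E)" "Pi\<^sub>E UNIV U"] by blast
  then obtain p where p: "p \<in> Pi\<^sub>E UNIV U" "p \<notin> W - E" "p \<notin> \<phi> ` (W - E)"
    by blast
  have "\<phi> p \<notin> W - E"
    using p(3) imageI[of "\<phi> p" "W - E" \<phi>] unfolding invol by blast
  then have "p \<in> E" "\<phi> p \<in> E"
    using p(1,2) inv[OF p(1)] U(3) by blast+
  then show thesis
    unfolding \<phi>_def by (rule that)
qed

text \<open>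
  The analogue of the theorems of Steinhaus and Pettis. If it fails, there are elements \<open>v n\<close> that
  are not differences of elements of \<open>B\<close> and tend to zero as fast as required. The sum of the
  \<open>v n\<close> over the coordinates with value \<open>True\<close> is then a continuous map on the Cantor space, and it
  witnesses that \<open>B\<close> is Haar meager: flipping coordinate \<open>n\<close> changes the sum by \<open>v n\<close>, so the
  preimage of a translate of \<open>B\<close> cannot contain a point together with its flip.
\<close>

theorem differences_nbhd_zero:
  fixes B :: "'a::{polish_space, topological_ab_group_add} set"
  assumes B: "B \<in> sets borel" "\<not> haar_meager B"
  shows "\<exists>V. open V \<and> 0 \<in> V \<and> (\<forall>v\<in>V. \<exists>x\<in>B. \<exists>y\<in>B. v = x - y)"
proof (rule ccontr)
  assume no: "\<not> ?thesis"
  define Q where "Q H \<longleftrightarrow> (\<exists>v. \<not> (\<exists>x\<in>B. \<exists>y\<in>B. v = x - y) \<and> H = {0, v})" for H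
  have small: "\<exists>H. compact H \<and> H \<subseteq> V \<and> Q H" if V: "open V" "0 \<in> V" for V
  proof -
    obtain v where "v \<in> V" "\<not> (\<exists>x\<in>B. \<exists>y\<in>B. v = x - y)"
      using no V by blast
    then show ?thesis
      using V(2) unfolding Q_def by (intro exI[of _ "{0, v}"] conjI exI[of _ v]) simp_all
  qed
  obtain H where H: "\<forall>n::nat. Q (H n)"
    "\<forall>s n. (\<forall>i. s i \<in> H i) \<longrightarrow> dist (sum s {..<Suc n}) (sum s {..<n}) < (1/2) ^ n"
    by (rule exists_summable_sets[of "\<lambda>_. Q", OF small])
  obtain v where v: "\<And>n. \<not> (\<exists>x\<in>B. \<exists>y\<in>B. v n = x - y)" "\<And>n. H n = {0, v n}"
    using H(1) unfolding Q_def by metis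
  define T where "T = (\<lambda>_ :: nat. discrete_topology (UNIV :: bool set))"
  define h where "h n b = (if b then v n else 0)" for n b
  let ?P = "product_topology T UNIV"
  have h_small: "dist (\<Sum>i<Suc n. h i (p i)) (\<Sum>i<n. h i (p i)) < (1/2) ^ n" for p n
    by (intro H(2)[rule_format]) (simp add: h_def v(2))
  have "continuous_map (T n) euclidean (h n)" for n
    unfolding T_def by simp
  then obtain g where g: "continuous_map ?P euclidean g"
      "\<forall>p\<in>topspace ?P. (\<lambda>n. h n (p n)) sums g p"
    by (rule continuous_map_suminf_product[of T h, OF _ h_small])
  have top: "topspace ?P = UNIV"
    unfolding T_def by simp
  have "meager_in ?P {p \<in> topspace ?P. g p - x \<in> B}" for x
  proof (rule ccontr)
    assume "\<not> meager_in ?P {p \<in> topspace ?P. g p - x \<in> B}"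
    moreover have "has_Baire_property ?P {p \<in> topspace ?P. g p - x \<in> B}"
      using continuous_map_minus_const[OF g(1)] B(1) by (rule Borel_preimage_has_Baire_property)
    ultimately obtain p n where "p \<in> {p \<in> topspace ?P. g p - x \<in> B}"
        "p(n := \<not> p n) \<in> {p \<in> topspace ?P. g p - x \<in> B}"
      unfolding T_def by (elim nonmeager_Baire_contains_flip[rotated])
    then have p: "g p - x \<in> B" "g (p(n := \<not> p n)) - x \<in> B"
      by simp_all
    have "g (p(n := \<not> p n)) = h n (\<not> p n) + (g p - h n (p n))"
    proof (rule sums_unique2)
      show "(\<lambda>i. h i ((p(n := \<not> p n)) i)) sums g (p(n := \<not> p n))"
        by (rule bspec[OF g(2)]) (simp only: top UNIV_I)
      show "(\<lambda>i. h i ((p(n := \<not> p n)) i)) sums (h n (\<not> p n) + (g p - h n (p n)))"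
        using bspec[OF g(2)] by (intro sums_fun_upd[of h p]) (simp only: top UNIV_I)
    qed
    then have "v n = (g p - x) - (g (p(n := \<not> p n)) - x) \<or> v n = (g (p(n := \<not> p n)) - x) - (g p - x)"
      by (cases "p n") (simp_all add: h_def)
    then show False
    proof
      assume "v n = (g p - x) - (g (p(n := \<not> p n)) - x)"
      then show False using v(1)[of n] p by blast
    next
      assume "v n = (g (p(n := \<not> p n)) - x) - (g p - x)"
      then show False using v(1)[of n] p by blast
    qed
  qed
  moreover have "compact_space ?P" "metrizable_space ?P"
    unfolding T_def
    by (simp_all add: compact_space_product_topology metrizable_space_product_topology compact_space_discrete_topology)
  ultimately have "haar_meager_witness B ?P g"
    unfolding haar_meager_witness_def using g(1) top by simp
  then have "haar_meager B"
    by (rule haar_meagerI_witness[OF B(1) order_refl])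
  with B(2) show False ..
qed

section \<open>Continuity of measurable homomorphisms\<close>

lemma ex_small_nbhd_differences:
  fixes W :: "'b::topological_ab_group_add set"
  assumes "open W" "0 \<in> W"
  obtains U where "open U" "0 \<in> U" "\<And>a b. a \<in> U \<Longrightarrow> b \<in> U \<Longrightarrow> a - b \<in> W"
proof -
  have "((\<lambda>(a, b). a - b) \<longlongrightarrow> 0 - (0 :: 'b)) (nhds (0, 0))"
    unfolding case_prod_beta nhds_prod by (intro tendsto_diff filterlim_fst filterlim_snd)
  then have "\<forall>\<^sub>F p in nhds (0, 0). fst p - snd p \<in> W"
    using assms by (auto simp: case_prod_beta dest: topological_tendstoD)
  then obtain S where S: "open S" "(0, 0) \<in> S" "\<And>p. p \<in> S \<Longrightarrow> fst p - snd p \<in> W"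
    unfolding eventually_nhds by blast
  obtain A B where AB: "open A" "open B" "(0, 0) \<in> A \<times> B" "A \<times> B \<subseteq> S"
    using S(1,2) by (rule open_prod_elim)
  have "a - b \<in> W" if "a \<in> A \<inter> B" "b \<in> A \<inter> B" for a b
    using S(3)[of "(a, b)"] AB(4) that by auto
  then show thesis
    using AB(1-3) by (intro that[of "A \<inter> B"]) auto
qed

lemma countable_translates_cover:
  fixes U :: "'b::{second_countable_topology, topological_ab_group_add} set"
  assumes "open U" "0 \<in> U"
  obtains y :: "nat \<Rightarrow> 'b" where "\<And>z. \<exists>n. z - y n \<in> U"
proof -
  obtain D :: "'b set" where D: "countable D" "\<And>X. open X \<Longrightarrow> X \<noteq> {} \<Longrightarrow> \<exists>d\<in>D. d \<in> X"
    by (rule countable_dense_setE) blast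
  have "\<exists>d\<in>D. z - d \<in> U" for z
  proof -
    have "open ((\<lambda>d. z - d) -` U)"
      using assms(1) by (intro open_vimage continuous_on_diff continuous_on_const continuous_on_id)
    moreover have "z \<in> (\<lambda>d. z - d) -` U" using assms(2) by simp
    ultimately show ?thesis using D(2)[of "(\<lambda>d. z - d) -` U"] by blast
  qed
  moreover have "D \<noteq> {}" using D(2)[of UNIV] by blast
  ultimately show thesis
    using that[of "from_nat_into D"] range_from_nat_into[OF \<open>D \<noteq> {}\<close> D(1)] by (metis imageE)
qed

lemma additive_continuous_if_at_zero:
  fixes f :: "'a::topological_ab_group_add \<Rightarrow> 'b::topological_ab_group_add"
  assumes f: "\<And>x y. f (x + y) = f x + f y"
    and zero: "\<And>W. open W \<Longrightarrow> 0 \<in> W \<Longrightarrow> \<exists>V. open V \<and> 0 \<in> V \<and> f ` V \<subseteq> W"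
  shows "continuous_on UNIV f"
  unfolding continuous_on_topological
proof (intro ballI allI impI)
  fix x S assume S: "open S" "f x \<in> S"
  have "open ((\<lambda>w. f x + w) -` S)"
    using S(1) by (intro open_vimage continuous_on_add continuous_on_const continuous_on_id)
  then obtain V where V: "open V" "0 \<in> V" "f ` V \<subseteq> (\<lambda>w. f x + w) -` S"
    using zero[of "(\<lambda>w. f x + w) -` S"] S(2) by auto
  have "open ((\<lambda>y. y - x) -` V)"
    using V(1) by (intro open_vimage continuous_on_diff continuous_on_const continuous_on_id)
  moreover have "x \<in> (\<lambda>y. y - x) -` V" using V(2) by simp
  moreover have "f y \<in> S" if "y \<in> (\<lambda>y. y - x) -` V" for y
    using V(3) that f[of x "y - x"] by auto
  ultimately show "\<exists>A. open A \<and> x \<in> A \<and> (\<forall>y\<in>UNIV. y \<in> A \<longrightarrow> f y \<in> S)"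
    by blast
qed

theorem theorem4:
  fixes f :: "'a::{polish_space, topological_ab_group_add} \<Rightarrow>
              'b::{polish_space, topological_ab_group_add}"
  assumes "\<And>x y. f (x + y) = f x + f y"
    and "D_measurable_map f"
  shows "continuous_on UNIV f"
proof (rule additive_continuous_if_at_zero[OF assms(1)])
  fix W :: "'b set" assume W: "open W" "0 \<in> W"
  obtain U where U: "open U" "0 \<in> U" "\<And>a b. a \<in> U \<Longrightarrow> b \<in> U \<Longrightarrow> a - b \<in> W"
    using ex_small_nbhd_differences[OF W] by blast
  obtain y :: "nat \<Rightarrow> 'b" where y: "\<And>z. \<exists>n. z - y n \<in> U"
    using countable_translates_cover[OF U(1,2)] by blast
  define A where "A n = f -` ((\<lambda>z. z - y n) -` U)" for n
  have cover: "(\<Union>n. A n) = UNIV"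
    using y unfolding A_def by blast
  have "D_measurable (A n)" for n
  proof -
    have "open ((\<lambda>z. z - y n) -` U)"
      using U(1) by (intro open_vimage continuous_on_diff continuous_on_const continuous_on_id)
    then show ?thesis
      using assms(2) unfolding D_measurable_map_def A_def by blast
  qed
  then obtain B M where B: "\<And>n. B n \<in> sets borel" and M: "\<And>n. haar_meager (M n)"
      and A: "\<And>n. A n = B n \<union> M n"
    unfolding D_measurable_def by metis
  have "\<exists>n. \<not> haar_meager (B n)"
  proof (rule ccontr)
    assume "\<not> ?thesis"
    \<comment> \<open>Both sequences are merged into one, so that their union is a single countable union.\<close>
    then have "haar_meager (case_sum B M (sum_decode k))" for k
      using M by (cases "sum_decode k") simp_all
    then have "haar_meager (\<Union>k. case_sum B M (sum_decode k))"
      by (rule haar_meager_UN)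
    moreover have "(\<Union>k. case_sum B M (sum_decode k)) = UNIV"
    proof -
      have "(\<Union>k. case_sum B M (sum_decode k)) = (\<Union>i\<in>range sum_decode. case_sum B M i)"
        by simp
      also have "\<dots> = (\<Union>n. B n) \<union> (\<Union>n. M n)"
        by (simp add: surj_sum_decode UNIV_sum)
      also have "\<dots> = UNIV"
        using cover unfolding A by blast
      finally show ?thesis .
    qed
    ultimately show False using not_haar_meager_UNIV[where 'a = 'a] by simp
  qed
  then obtain n V where V: "open V" "0 \<in> V" "\<And>v. v \<in> V \<Longrightarrow> \<exists>a\<in>B n. \<exists>b\<in>B n. v = a - b"
    using differences_nbhd_zero[OF B] by metis
  have "f v \<in> W" if v: "v \<in> V" for v
  proof -
    obtain a b where ab: "a \<in> B n" "b \<in> B n" "v = a - b"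
      using V(3)[OF v] by blast
    have "a \<in> A n" "b \<in> A n"
      using ab(1,2) A by blast+
    then have "f a - y n \<in> U" "f b - y n \<in> U"
      unfolding A_def by simp_all
    then have "(f a - y n) - (f b - y n) \<in> W"
      by (rule U(3))
    moreover have "f v = f a - f b"
      using assms(1)[of v b] unfolding ab(3) by (simp add: eq_diff_eq)
    ultimately show ?thesis by simp
  qed
  with V(1,2) show "\<exists>V. open V \<and> 0 \<in> V \<and> f ` V \<subseteq> W" by blast
qed

end
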